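(* For every integer $n\ge1$, $$\mathrm{int}(\mathcal{CS}_+^n)\subseteq\bigcup_{r\ge1}\mathcal C^n_r\subseteq\mathcal{CS}_+^n ,$$ where $\mathrm{int}$ denotes the interior in $\mathcal S^n$.
   Context: $\mathcal S^n$ is the space of real symmetric $n\times n$ matrices with trace inner product $\langle X,Y\rangle=\mathrm{Tr}(XY)$ ($\mathrm{Tr}$ is the usual, non-normalized trace), and $\mathcal S^d_+\subseteq \mathcal S^d$ is the cone of positive semidefinite matrices. The completely positive semidefinite cone $\mathcal{CS}_+^n$ is the set of $A\in\mathcal S^n$ of the form $A=(\langle X_i,X_j\rangle)_{i,j=1}^n$ for some $d\ge1$ and some $X_1,\dots,X_n\in\mathcal S^d_+$. For an integer $r\ge1$, let $\underline{\mathbf\Delta}(n,r)$ be the set of tuples $(X_1,\dots,X_n)\in(\mathcal S^r_+)^n$ of $r\times r$ positive semidefinite matrices with $\sum_{i=1}^n\mathrm{Tr}(X_i)=1$ such that all entries of each $X_i$ are rational with denominator at most $r$ (i.e. each entry can be written as $p/q$ with $p,q\in\mathbb Z$, $1\le q\le r$). The cone $\mathcal C^n_r$ is the conic hull (set of all finite nonnegative linear combinations) of the matrices $(\langle X_i,X_j\rangle)_{i,j=1}^n$ with $(X_1,\dots,X_n)\in\underline{\mathbf\Delta}(n,r)$. *)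

theory Defs
  imports "HOL-Analysis.Analysis" "Jordan_Normal_Form.Matrix"
begin

text \<open>
  The tuples are indexed by a finite type \<open>'n\<close> with \<open>CARD('n) = n\<close>, so \<open>n \<ge> 1\<close> is automatic and
  symmetric \<open>n \<times> n\<close> matrices have type \<open>real^'n^'n\<close>.  The size \<open>d\<close> (resp. \<open>r\<close>) of the members
  of a tuple is quantified, hence these are of type \<open>real mat\<close> with an explicit carrier.
\<close>

definition sym_mats :: "(real^'n^'n) set" where
  "sym_mats = {A. transpose A = A}"

definition psd_mats :: "nat \<Rightarrow> real mat set" where
  "psd_mats d = {X \<in> carrier_mat d d. transpose_mat X = X \<and>
      (\<forall>v \<in> carrier_vec d. 0 \<le> scalar_prod v (X *\<^sub>v v))}"

definition mat_trace :: "real mat \<Rightarrow> real" where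
  "mat_trace X = (\<Sum>k<dim_row X. X $$ (k, k))"

definition trace_inner :: "real mat \<Rightarrow> real mat \<Rightarrow> real" where
  "trace_inner X Y = mat_trace (X * Y)"

definition gram_matrix :: "('n::finite \<Rightarrow> real mat) \<Rightarrow> real^'n^'n" where
  "gram_matrix X = (\<chi> i j. trace_inner (X i) (X j))"

definition cpsd_cone :: "(real^'n::finite^'n) set" where
  "cpsd_cone = {A \<in> sym_mats. \<exists>d\<ge>1. \<exists>X. (\<forall>i. X i \<in> psd_mats d) \<and> A = gram_matrix X}"

definition Delta_rat :: "nat \<Rightarrow> ('n::finite \<Rightarrow> real mat) set" where
  "Delta_rat r = {X. (\<forall>i. X i \<in> psd_mats r) \<and> (\<Sum>i\<in>UNIV. mat_trace (X i)) = 1 \<and>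
      (\<forall>i. \<forall>k<r. \<forall>l<r. \<exists>p q :: int. 1 \<le> q \<and> q \<le> int r \<and>
         X i $$ (k, l) = real_of_int p / real_of_int q)}"

text \<open>
  The library's \<open>conic hull\<close> closes only under nonnegative scaling.  The set of all finite
  nonnegative linear combinations is \<open>convex_cone hull\<close>, as the following lemma confirms.
\<close>

lemma convex_cone_hull_eq_nonneg_combinations:
  fixes S :: "'a::real_vector set"
  shows "convex_cone hull S =
    {\<Sum>a\<in>F. c a *\<^sub>R a | F c. finite F \<and> F \<subseteq> S \<and> (\<forall>a\<in>F. 0 \<le> c a)}" (is "_ = ?R")
proof
  show "convex_cone hull S \<subseteq> ?R"
  proof (rule hull_minimal)
    show "S \<subseteq> ?R"
    proof
      fix x assume "x \<in> S"
      then show "x \<in> ?R"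
        by (intro CollectI exI[of _ "{x}"] exI[of _ "\<lambda>_. 1"]) auto
    qed
    show "convex_cone ?R"
      unfolding convex_cone_iff
    proof (intro conjI ballI allI impI)
      show "0 \<in> ?R"
        by (intro CollectI exI[of _ "{}"] exI[of _ "\<lambda>_. 0"]) auto
    next
      fix x y assume "x \<in> ?R" "y \<in> ?R"
      then obtain F c G d where
        F: "finite F" "F \<subseteq> S" "\<forall>a\<in>F. 0 \<le> c a" "x = (\<Sum>a\<in>F. c a *\<^sub>R a)" and
        G: "finite G" "G \<subseteq> S" "\<forall>a\<in>G. 0 \<le> d a" "y = (\<Sum>a\<in>G. d a *\<^sub>R a)"
        by blast
      let ?e = "\<lambda>a. (if a \<in> F then c a else 0) + (if a \<in> G then d a else 0)"
      have "x = (\<Sum>a\<in>F \<union> G. (if a \<in> F then c a else 0) *\<^sub>R a)"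
        unfolding F(4) by (rule sum.mono_neutral_cong_left) (use F G in auto)
      moreover have "y = (\<Sum>a\<in>F \<union> G. (if a \<in> G then d a else 0) *\<^sub>R a)"
        unfolding G(4) by (rule sum.mono_neutral_cong_left) (use F G in auto)
      ultimately have "x + y = (\<Sum>a\<in>F \<union> G. ?e a *\<^sub>R a)"
        by (simp add: sum.distrib scaleR_add_left)
      then show "x + y \<in> ?R"
        using F(1-3) G(1-3) by (intro CollectI exI[of _ "F \<union> G"] exI[of _ ?e]) auto
    next
      fix x and t :: real assume "x \<in> ?R" "0 \<le> t"
      then obtain F c where
        F: "finite F" "F \<subseteq> S" "\<forall>a\<in>F. 0 \<le> c a" "x = (\<Sum>a\<in>F. c a *\<^sub>R a)"
        by blast
      then show "t *\<^sub>R x \<in> ?R"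
        using \<open>0 \<le> t\<close>
        by (intro CollectI exI[of _ F] exI[of _ "\<lambda>a. t * c a"]) (auto simp: scaleR_sum_right)
    qed
  qed
  show "?R \<subseteq> convex_cone hull S"
  proof
    fix x assume "x \<in> ?R"
    then obtain F c where
      F: "finite F" "F \<subseteq> S" "\<forall>a\<in>F. 0 \<le> c a" "x = (\<Sum>a\<in>F. c a *\<^sub>R a)"
      by blast
    have "(\<Sum>a\<in>F. c a *\<^sub>R a) \<in> convex_cone hull S"
      using F(1-3)
      by (induction F rule: finite_induct)
        (auto simp: convex_cone_hull_contains_0
          intro!: convex_cone_hull_add convex_cone_hull_mul intro: subsetD[OF hull_subset])
    then show "x \<in> convex_cone hull S" using F(4) by simp
  qed
qed

definition C_cone :: "nat \<Rightarrow> (real^'n::finite^'n) set" where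
  "C_cone r = convex_cone hull (gram_matrix ` Delta_rat r)"

end

theory Submission
  imports Defs
begin

text \<open>
  Zero padding makes the cones \<open>C_cone r\<close> increase with \<open>r\<close>, so their union \<open>C\<close> is convex.  It is
  dense in the completely positive semidefinite cone: rounding a tuple to multiples of \<open>1 / m\<close> and
  shifting it by \<open>(d / m) I\<close> keeps it positive semidefinite, and dividing by the positive total trace
  \<open>N / m\<close> leaves entries with denominator \<open>N\<close>.  A convex set has the same relative interior as its
  closure, so every interior point of the cone already lies in \<open>C\<close>.
\<close>

section \<open>Trace inner product and positive semidefiniteness in coordinates\<close>

lemma trace_inner_eq_sum:
  assumes "X \<in> carrier_mat d d" "Y \<in> carrier_mat d d"
  shows "trace_inner X Y = (\<Sum>k<d. \<Sum>l<d. X $$ (k, l) * Y $$ (l, k))"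
  using assms
  by (auto simp: trace_inner_def mat_trace_def scalar_prod_def lessThan_atLeast0 intro!: sum.cong)

lemma quadratic_form_eq_sum:
  fixes X :: "real mat"
  assumes "X \<in> carrier_mat d d" "v \<in> carrier_vec d"
  shows "scalar_prod v (X *\<^sub>v v)
    = (\<Sum>k<d. \<Sum>l<d. X $$ (k, l) * (vec_index v k * vec_index v l))"
  using assms
  by (auto simp: scalar_prod_def lessThan_atLeast0 sum_distrib_left mult_ac intro!: sum.cong)

lemma psd_mats_carrier: "X \<in> psd_mats d \<Longrightarrow> X \<in> carrier_mat d d"
  by (simp add: psd_mats_def)

text \<open>Test vectors are replaced by arbitrary functions on \<open>nat\<close>, of which only
  the values below \<open>d\<close> matter. No carrier condition has to be carried along, and
  restricting a test vector to a diagonal block becomes a mere shift of the argument.\<close>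

lemma psd_mats_iff:
  "X \<in> psd_mats d \<longleftrightarrow> X \<in> carrier_mat d d \<and> (\<forall>k<d. \<forall>l<d. X $$ (k, l) = X $$ (l, k)) \<and>
    (\<forall>f. 0 \<le> (\<Sum>k<d. \<Sum>l<d. X $$ (k, l) * (f k * f l)))"
  (is "?L \<longleftrightarrow> ?C \<and> ?S \<and> ?P")
proof (cases ?C)
  case True
  have "transpose_mat X = X \<longleftrightarrow> ?S"
  proof
    assume "transpose_mat X = X"
    then show ?S
      using True by (metis carrier_matD index_transpose_mat(1))
  next
    assume ?S
    then show "transpose_mat X = X"
      using True by (intro eq_matI) auto
  qed
  moreover have "(\<forall>v \<in> carrier_vec d. 0 \<le> scalar_prod v (X *\<^sub>v v)) \<longleftrightarrow> ?P"
  proof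
    assume *: "\<forall>v \<in> carrier_vec d. 0 \<le> scalar_prod v (X *\<^sub>v v)"
    show ?P
    proof
      fix f :: "nat \<Rightarrow> real"
      have "0 \<le> scalar_prod (Matrix.vec d f) (X *\<^sub>v Matrix.vec d f)"
        using * by simp
      then show "0 \<le> (\<Sum>k<d. \<Sum>l<d. X $$ (k, l) * (f k * f l))"
        by (simp add: quadratic_form_eq_sum[OF True])
    qed
  qed (use quadratic_form_eq_sum[OF True] in auto)
  ultimately show ?thesis
    using True by (simp add: psd_mats_def)
qed (simp add: psd_mats_def)

lemma psd_mats_smult:
  assumes "X \<in> psd_mats d" "0 \<le> c"
  shows "c \<cdot>\<^sub>m X \<in> psd_mats d"
  using assms
  by (auto simp: psd_mats_iff mult.assoc simp flip: sum_distrib_left)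

lemma psd_mats_zero: "0\<^sub>m d d \<in> psd_mats d"
  by (auto simp: psd_mats_iff)

lemma psd_mats_diag_nonneg:
  assumes "X \<in> psd_mats d" "k < d"
  shows "0 \<le> X $$ (k, k)"
proof -
  \<comment> \<open>The test vector is the \<open>k\<close>-th standard basis vector, so the
    quadratic form collapses to the diagonal entry.\<close>
  have "0 \<le> (\<Sum>i<d. \<Sum>j<d. X $$ (i, j) * (of_bool (i = k) * of_bool (j = k)))"
    using assms by (simp add: psd_mats_iff)
  also have "\<dots> = (\<Sum>i<d. if i = k then X $$ (i, k) else 0)"
    by (intro sum.cong) (use assms(2) in \<open>auto simp: of_bool_def if_distrib cong: if_cong\<close>)
  finally show ?thesis
    using assms(2) by simp
qed

section \<open>Gram matrices under scaling and direct sums\<close>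

lemma gram_matrix_smult:
  assumes "\<And>i. X i \<in> carrier_mat d d"
  shows "gram_matrix (\<lambda>i. c \<cdot>\<^sub>m X i) = c\<^sup>2 *\<^sub>R gram_matrix X"
proof -
  have "trace_inner (c \<cdot>\<^sub>m X i) (c \<cdot>\<^sub>m X j) = c\<^sup>2 * trace_inner (X i) (X j)" for i j
    using assms[of i] assms[of j]
    by (simp add: trace_inner_eq_sum[of _ d] sum_distrib_left power2_eq_square mult_ac)
  then show ?thesis
    by (simp add: gram_matrix_def Finite_Cartesian_Product.vec_eq_iff)
qed

text \<open>The direct sum of two matrices. It serves twice: direct sums of tuples realise sums of
  Gram matrices, and a zero second block enlarges the matrices without changing the Gram
  matrix.\<close>

definition diag_sum :: "real mat \<Rightarrow> real mat \<Rightarrow> real mat" where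
  "diag_sum X Y = four_block_mat X (0\<^sub>m (dim_row X) (dim_col Y)) (0\<^sub>m (dim_row Y) (dim_col X)) Y"

lemma diag_sum_carrier:
  assumes "X \<in> carrier_mat d d" "Y \<in> carrier_mat e e"
  shows "diag_sum X Y \<in> carrier_mat (d + e) (d + e)"
  using assms by (auto simp: diag_sum_def)

lemma diag_sum_index:
  assumes "X \<in> carrier_mat d d" "Y \<in> carrier_mat e e" "k < d + e" "l < d + e"
  shows "diag_sum X Y $$ (k, l) =
    (if k < d \<and> l < d then X $$ (k, l)
     else if k \<ge> d \<and> l \<ge> d then Y $$ (k - d, l - d) else 0)"
  using assms by (auto simp: diag_sum_def)

lemma sum_lessThan_add: "(\<Sum>k<d + e. f k) = (\<Sum>k<d. f k) + (\<Sum>k<e. f (d + k))"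
  for f :: "nat \<Rightarrow> 'a::comm_monoid_add"
  by (induction e) (simp_all add: add.assoc)

text \<open>The weight \<open>g\<close> is left arbitrary so that one computation covers both uses:
  \<open>f k * f l\<close> gives the quadratic form, and the \<open>(l, k)\<close> entry of a second
  matrix gives the trace inner product.\<close>

lemma sum_diag_sum:
  fixes g :: "nat \<Rightarrow> nat \<Rightarrow> real"
  assumes "X \<in> carrier_mat d d" "Y \<in> carrier_mat e e"
  shows "(\<Sum>k<d + e. \<Sum>l<d + e. diag_sum X Y $$ (k, l) * g k l) =
    (\<Sum>k<d. \<Sum>l<d. X $$ (k, l) * g k l) + (\<Sum>k<e. \<Sum>l<e. Y $$ (k, l) * g (d + k) (d + l))"
  unfolding sum_lessThan_add
  by (simp add: diag_sum_index[OF assms])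

lemma psd_mats_diag_sum:
  assumes "X \<in> psd_mats d" "Y \<in> psd_mats e"
  shows "diag_sum X Y \<in> psd_mats (d + e)"
proof -
  have c: "X \<in> carrier_mat d d" "Y \<in> carrier_mat e e"
    using assms by (auto simp: psd_mats_carrier)
  have "0 \<le> (\<Sum>k<d + e. \<Sum>l<d + e. diag_sum X Y $$ (k, l) * (f k * f l))" for f
    unfolding sum_diag_sum[OF c] using assms by (auto simp: psd_mats_iff intro!: add_nonneg_nonneg)
  then show ?thesis
    using assms by (auto simp: psd_mats_iff diag_sum_carrier diag_sum_index[OF c])
qed

lemma trace_inner_diag_sum:
  assumes "X \<in> carrier_mat d d" "Y \<in> carrier_mat e e" "X' \<in> carrier_mat d d" "Y' \<in> carrier_mat e e"
  shows "trace_inner (diag_sum X Y) (diag_sum X' Y') = trace_inner X X' + trace_inner Y Y'"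
  using assms
  by (simp add: trace_inner_eq_sum[of _ "d + e"] trace_inner_eq_sum[of _ d]
      trace_inner_eq_sum[of _ e] diag_sum_carrier sum_diag_sum[OF assms(1,2)]
      diag_sum_index[OF assms(3,4)])

lemma mat_trace_diag_sum:
  assumes "X \<in> carrier_mat d d" "Y \<in> carrier_mat e e"
  shows "mat_trace (diag_sum X Y) = mat_trace X + mat_trace Y"
  using assms diag_sum_carrier[OF assms]
  by (simp add: mat_trace_def sum_lessThan_add diag_sum_index[OF assms])

lemma gram_matrix_diag_sum:
  assumes "\<And>i. X i \<in> carrier_mat d d" "\<And>i. Y i \<in> carrier_mat e e"
  shows "gram_matrix (\<lambda>i. diag_sum (X i) (Y i)) = gram_matrix X + gram_matrix Y"
  by (simp add: gram_matrix_def Finite_Cartesian_Product.vec_eq_iff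
      trace_inner_diag_sum[OF assms assms])

lemma gram_matrix_zero: "gram_matrix (\<lambda>i. 0\<^sub>m d d) = 0"
  by (simp add: gram_matrix_def Finite_Cartesian_Product.vec_eq_iff trace_inner_eq_sum[of _ d])

lemma gram_matrix_in_sym_mats:
  assumes "\<And>i. X i \<in> carrier_mat d d"
  shows "gram_matrix X \<in> sym_mats"
proof -
  have "trace_inner (X j) (X i) = trace_inner (X i) (X j)" for i j
    using assms[of i] assms[of j]
    by (simp add: trace_inner_eq_sum[of _ d] mult.commute[of "X j $$ _"]) (rule sum.swap)
  then show ?thesis
    by (simp add: sym_mats_def Finite_Cartesian_Product.transpose_def gram_matrix_def
        Finite_Cartesian_Product.vec_eq_iff)
qed

section \<open>The completely positive semidefinite cone is a convex cone\<close>

lemma gram_matrix_in_cpsd_cone: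
  assumes "\<And>i. X i \<in> psd_mats d" "d \<ge> 1"
  shows "gram_matrix X \<in> cpsd_cone"
  using assms gram_matrix_in_sym_mats[of X d] by (auto simp: cpsd_cone_def psd_mats_carrier)

text \<open>Direct sums of tuples, possibly of different sizes, realise addition. Since the Gram
  matrix is quadratic in the tuple, a factor \<open>c\<close> is realised by scaling every member by
  \<open>sqrt c\<close>.\<close>

lemma convex_cone_cpsd_cone: "convex_cone cpsd_cone"
  unfolding convex_cone_iff
proof (intro conjI ballI allI impI)
  show "0 \<in> cpsd_cone"
    using gram_matrix_in_cpsd_cone[of "\<lambda>_. 0\<^sub>m 1 1" 1] by (simp add: psd_mats_zero gram_matrix_zero)
next
  fix A B :: "real^'n^'n"
  assume "A \<in> cpsd_cone" "B \<in> cpsd_cone"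
  then obtain d e X Y where *: "d \<ge> 1" "\<And>i. X i \<in> psd_mats d" "A = gram_matrix X"
      "\<And>i. Y i \<in> psd_mats e" "B = gram_matrix Y"
    by (auto simp: cpsd_cone_def)
  have "gram_matrix (\<lambda>i. diag_sum (X i) (Y i)) \<in> cpsd_cone"
    using * by (intro gram_matrix_in_cpsd_cone[of _ "d + e"] psd_mats_diag_sum) auto
  then show "A + B \<in> cpsd_cone"
    using * gram_matrix_diag_sum[of X d Y e] by (simp add: psd_mats_carrier)
next
  fix A :: "real^'n^'n" and c :: real
  assume "A \<in> cpsd_cone" "0 \<le> c"
  then obtain d X where *: "d \<ge> 1" "\<And>i. X i \<in> psd_mats d" "A = gram_matrix X"
    by (auto simp: cpsd_cone_def)
  have "gram_matrix (\<lambda>i. sqrt c \<cdot>\<^sub>m X i) \<in> cpsd_cone"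
    using * \<open>0 \<le> c\<close> by (intro gram_matrix_in_cpsd_cone[of _ d] psd_mats_smult) auto
  then show "c *\<^sub>R A \<in> cpsd_cone"
    using * \<open>0 \<le> c\<close> gram_matrix_smult[of X d "sqrt c"] by (simp add: psd_mats_carrier)
qed

lemma C_cone_subset_cpsd_cone:
  assumes "r \<ge> 1"
  shows "C_cone r \<subseteq> cpsd_cone"
  unfolding C_cone_def
  by (rule hull_minimal)
    (use assms in \<open>auto simp: Delta_rat_def convex_cone_cpsd_cone intro!: gram_matrix_in_cpsd_cone\<close>)

section \<open>Zero padding and the increasing chain of rational cones\<close>

lemma gram_matrix_pad_zero:
  assumes "\<And>i. X i \<in> carrier_mat d d"
  shows "gram_matrix (\<lambda>i. diag_sum (X i) (0\<^sub>m e e)) = gram_matrix X"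
  using gram_matrix_diag_sum[OF assms, of "\<lambda>_. 0\<^sub>m e e" e] by (simp add: gram_matrix_zero)

text \<open>\<open>Delta_rat r\<close> uses the same \<open>r\<close> for the matrix size and for
  the bound on denominators. Padding decouples the two: a tuple of smaller size \<open>d\<close>
  with denominators up to \<open>r\<close> is brought to size \<open>r\<close>. The total trace is
  unchanged and the new entries are 0/1.\<close>

lemma Delta_rat_pad_zero:
  assumes "\<And>i. X i \<in> psd_mats d" "(\<Sum>i\<in>UNIV. mat_trace (X i)) = 1" "d \<le> r"
    and rat: "\<And>i k l. k < d \<Longrightarrow> l < d \<Longrightarrow> \<exists>p q :: int. 1 \<le> q \<and> q \<le> int r \<and>
         X i $$ (k, l) = real_of_int p / real_of_int q"
  shows "(\<lambda>i. diag_sum (X i) (0\<^sub>m (r - d) (r - d))) \<in> Delta_rat r"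
proof -
  have c: "X i \<in> carrier_mat d d" for i
    using assms(1) by (rule psd_mats_carrier)
  have "diag_sum (X i) (0\<^sub>m (r - d) (r - d)) \<in> psd_mats r" for i
    using psd_mats_diag_sum[OF assms(1) psd_mats_zero, of i "r - d"] \<open>d \<le> r\<close> by simp
  moreover have "(\<Sum>i\<in>UNIV. mat_trace (diag_sum (X i) (0\<^sub>m (r - d) (r - d)))) = 1"
    using assms(2) by (simp add: mat_trace_diag_sum[OF c, of _ "r - d"]) (simp add: mat_trace_def)
  moreover have "\<exists>p q :: int. 1 \<le> q \<and> q \<le> int r \<and>
      diag_sum (X i) (0\<^sub>m (r - d) (r - d)) $$ (k, l) = real_of_int p / real_of_int q"
    if "k < r" "l < r" for i k l
  proof (cases "k < d \<and> l < d")
    case True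
    then show ?thesis
      using rat[of k l i] that \<open>d \<le> r\<close>
      by (simp add: diag_sum_index[OF c, of _ "r - d"])
  next
    case False
    then show ?thesis
      using that \<open>d \<le> r\<close>
      by (intro exI[of _ 0] exI[of _ 1]) (auto simp: diag_sum_index[OF c, of _ "r - d"])
  qed
  ultimately show ?thesis
    by (simp add: Delta_rat_def)
qed

lemma C_cone_mono:
  assumes "d \<le> r"
  shows "C_cone d \<subseteq> C_cone r"
  unfolding C_cone_def
proof (rule hull_mono, rule image_subsetI)
  fix X :: "'n::finite \<Rightarrow> real mat"
  assume X: "X \<in> Delta_rat d"
  then have psd: "X i \<in> psd_mats d" for i
    by (simp add: Delta_rat_def)
  have "(\<lambda>i. diag_sum (X i) (0\<^sub>m (r - d) (r - d))) \<in> Delta_rat r"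
  proof (rule Delta_rat_pad_zero[OF psd])
    fix i k l assume "k < d" "l < d"
    then obtain p q :: int where "1 \<le> q" "q \<le> int d" "X i $$ (k, l) = real_of_int p / real_of_int q"
      using X by (force simp: Delta_rat_def)
    then show "\<exists>p q :: int. 1 \<le> q \<and> q \<le> int r \<and> X i $$ (k, l) = real_of_int p / real_of_int q"
      using assms by (intro exI[of _ p] exI[of _ q]) auto
  qed (use X assms in \<open>auto simp: Delta_rat_def\<close>)
  then show "gram_matrix X \<in> gram_matrix ` Delta_rat r"
    using gram_matrix_pad_zero[of X d "r - d"] psd by (metis imageI psd_mats_carrier)
qed

lemma convex_Union_C_cone: "convex (\<Union>r\<in>{1..}. C_cone r)"
proof (rule convexI)
  fix A B :: "real^'n^'n" and u v :: real
  assume "A \<in> (\<Union>r\<in>{1..}. C_cone r)" "B \<in> (\<Union>r\<in>{1..}. C_cone r)"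
    and uv: "0 \<le> u" "0 \<le> v" "u + v = 1"
  then obtain r s where "r \<ge> 1" "A \<in> C_cone r" "B \<in> C_cone s"
    by auto
  then have "A \<in> C_cone (max r s)" "B \<in> C_cone (max r s)"
    using C_cone_mono[of r "max r s"] C_cone_mono[of s "max r s"] by auto
  then have "u *\<^sub>R A + v *\<^sub>R B \<in> C_cone (max r s)"
    unfolding C_cone_def using uv by (intro convex_cone_hull_add convex_cone_hull_mul) auto
  then show "u *\<^sub>R A + v *\<^sub>R B \<in> (\<Union>r\<in>{1..}. C_cone r)"
    using \<open>r \<ge> 1\<close> by force
qed

section \<open>Rational approximation that preserves positive semidefiniteness\<close>

lemma psd_mats_perturb:
  assumes X: "X \<in> psd_mats d" and Y: "Y \<in> carrier_mat d d"
    and sym: "\<And>k l. k < d \<Longrightarrow> l < d \<Longrightarrow> Y $$ (k, l) = Y $$ (l, k)"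
    and near: "\<And>k l. k < d \<Longrightarrow> l < d \<Longrightarrow>
      \<bar>Y $$ (k, l) - (if k = l then c * d else 0) - X $$ (k, l)\<bar> \<le> c"
    and "0 \<le> c"
  shows "Y \<in> psd_mats d"
proof -
  \<comment> \<open>Write Y = X + c d I + E, where every entry of E is at most \<open>c\<close> in
    absolute value. The form of E at \<open>f\<close> is at least -c times the square of the sum of
    the \<open>\<bar>f k\<bar>\<close>, and by Cauchy-Schwarz that square is at most d times the sum
    of the squares. The shift c d I therefore absorbs the error.\<close>
  have "0 \<le> (\<Sum>k<d. \<Sum>l<d. Y $$ (k, l) * (f k * f l))" for f
  proof -
    have "(\<Sum>k<d. \<bar>f k\<bar>)\<^sup>2 \<le> (\<Sum>k<d. (f k)\<^sup>2) * d"
      using sum_squared_le_sum_of_squares[of "\<lambda>k. \<bar>f k\<bar>" "{..<d}"] by simp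
    then have "c * (\<Sum>k<d. \<bar>f k\<bar>)\<^sup>2 \<le> c * ((\<Sum>k<d. (f k)\<^sup>2) * d)"
      using \<open>0 \<le> c\<close> by (rule mult_left_mono)
    moreover have "(\<Sum>k<d. \<Sum>l<d. c * (\<bar>f k\<bar> * \<bar>f l\<bar>)) = c * (\<Sum>k<d. \<bar>f k\<bar>)\<^sup>2"
      unfolding power2_eq_square sum_product by (simp add: sum_distrib_left)
    moreover have "(\<Sum>k<d. \<Sum>l<d. (if k = l then c * d else 0) * (f k * f l))
        = c * ((\<Sum>k<d. (f k)\<^sup>2) * d)"
    proof -
      have "(\<Sum>l<d. (if k = l then c * d else 0) * (f k * f l)) = c * d * (f k)\<^sup>2" if "k < d" for k
      proof -
        have "(\<Sum>l<d. (if k = l then c * d else 0) * (f k * f l))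
            = (\<Sum>l<d. if k = l then c * d * (f k * f l) else 0)"
          by (intro sum.cong) auto
        then show ?thesis
          using that by (simp add: power2_eq_square)
      qed
      then show ?thesis
        by (simp add: sum_distrib_left sum_distrib_right mult_ac)
    qed
    moreover have "(\<Sum>k<d. \<Sum>l<d. X $$ (k, l) * (f k * f l) +
          (if k = l then c * d else 0) * (f k * f l) - c * (\<bar>f k\<bar> * \<bar>f l\<bar>))
        \<le> (\<Sum>k<d. \<Sum>l<d. Y $$ (k, l) * (f k * f l))"
    proof (intro sum_mono)
      fix k l assume "k \<in> {..<d}" "l \<in> {..<d}"
      let ?e = "Y $$ (k, l) - (if k = l then c * d else 0) - X $$ (k, l)"
      have "\<bar>?e * (f k * f l)\<bar> \<le> c * (\<bar>f k\<bar> * \<bar>f l\<bar>)"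
        unfolding abs_mult using near[of k l] \<open>k \<in> _\<close> \<open>l \<in> _\<close> by (intro mult_right_mono) auto
      then have "- (c * (\<bar>f k\<bar> * \<bar>f l\<bar>)) \<le> ?e * (f k * f l)"
        by linarith
      then show "X $$ (k, l) * (f k * f l) + (if k = l then c * d else 0) * (f k * f l)
          - c * (\<bar>f k\<bar> * \<bar>f l\<bar>) \<le> Y $$ (k, l) * (f k * f l)"
        by (simp only: left_diff_distrib)
    qed
    moreover have "0 \<le> (\<Sum>k<d. \<Sum>l<d. X $$ (k, l) * (f k * f l))"
      using X by (simp add: psd_mats_iff)
    ultimately show ?thesis
      by (simp add: sum.distrib sum_subtractf)
  qed
  then show ?thesis
    using Y sym by (auto simp: psd_mats_iff)
qed

text \<open>The integer numerators are named separately because normalising the trace keeps them and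
  only exchanges the denominator \<open>m\<close> for another integer. The summand \<open>d\<close>
  on the diagonal becomes the shift by (d / m) I.\<close>

definition round_num :: "nat \<Rightarrow> nat \<Rightarrow> real mat \<Rightarrow> nat \<Rightarrow> nat \<Rightarrow> int" where
  "round_num d m X k l = \<lfloor>real m * X $$ (k, l)\<rfloor> + (if k = l then int d else 0)"

definition round_mat :: "nat \<Rightarrow> nat \<Rightarrow> real mat \<Rightarrow> real mat" where
  "round_mat d m X = Matrix.mat d d (\<lambda>(k, l). real_of_int (round_num d m X k l) / real m)"

lemma round_mat_index:
  "k < d \<Longrightarrow> l < d \<Longrightarrow> round_mat d m X $$ (k, l) = real_of_int (round_num d m X k l) / real m"
  by (simp add: round_mat_def)

lemma round_mat_carrier: "round_mat d m X \<in> carrier_mat d d"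
  by (simp add: round_mat_def)

lemma abs_floor_mult_div_le:
  fixes x :: real
  assumes "m > 0"
  shows "\<bar>of_int \<lfloor>real m * x\<rfloor> / real m - x\<bar> \<le> 1 / real m"
proof -
  have "of_int \<lfloor>real m * x\<rfloor> / real m - x = (of_int \<lfloor>real m * x\<rfloor> - real m * x) / real m"
    using assms by (simp add: field_simps)
  moreover have "\<bar>of_int \<lfloor>real m * x\<rfloor> - real m * x\<bar> \<le> 1"
    by linarith
  ultimately show ?thesis
    using assms by (simp add: divide_right_mono)
qed

text \<open>Rounding down moves each entry by at most 1 / m, and the diagonal shift d / m is exactly
  \<open>d\<close> times this bound, as the perturbation lemma demands. Symmetry survives because
  equal entries are rounded equally.\<close>

lemma psd_round_mat:
  assumes "X \<in> psd_mats d" "m > 0"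
  shows "round_mat d m X \<in> psd_mats d"
proof (rule psd_mats_perturb[OF assms(1) round_mat_carrier, where c = "1 / real m"])
  fix k l assume kl: "k < d" "l < d"
  show "round_mat d m X $$ (k, l) = round_mat d m X $$ (l, k)"
    using kl assms(1) by (simp add: round_mat_index round_num_def psd_mats_iff)
  show "\<bar>round_mat d m X $$ (k, l) - (if k = l then 1 / real m * real d else 0) - X $$ (k, l)\<bar>
      \<le> 1 / real m"
    using kl abs_floor_mult_div_le[OF assms(2), of "X $$ (k, l)"]
    by (cases "k = l") (simp_all add: round_mat_index round_num_def add_divide_distrib)
qed simp

lemma gram_round_mat_in_Union_C_cone:
  assumes "\<And>i. X i \<in> psd_mats d" "d \<ge> 1" "m > 0"
  shows "gram_matrix (\<lambda>i. round_mat d m (X i)) \<in> (\<Union>r\<in>{1..}. C_cone r)"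
proof -
  define Y where "Y i = round_mat d m (X i)" for i
  define N where "N = (\<Sum>i\<in>UNIV. \<Sum>k<d. round_num d m (X i) k k)"
  have psd: "Y i \<in> psd_mats d" for i
    unfolding Y_def using assms by (intro psd_round_mat) auto
  \<comment> \<open>The shift makes each diagonal numerator at least \<open>d\<close>, hence
    positive even when \<open>X i\<close> is zero. This allows the division by the total
    trace.\<close>
  have "0 < round_num d m (X i) k k" if "k < d" for i k
    using that psd_mats_diag_nonneg[OF assms(1) that, of i]
    by (auto simp: round_num_def intro!: add_nonneg_pos)
  then have "N > 0"
    unfolding N_def using \<open>d \<ge> 1\<close> by (intro sum_pos) (auto simp: lessThan_empty_iff)
  have tr: "(\<Sum>i\<in>UNIV. mat_trace (Y i)) = N / m"
    by (simp add: Y_def N_def mat_trace_def round_mat_index sum_divide_distrib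
        carrier_matD[OF round_mat_carrier])
  \<comment> \<open>The reciprocal of the total trace. Multiplying by it cancels the denominator
    \<open>m\<close> and leaves the common denominator \<open>N\<close> in all entries.\<close>
  define c where "c = m / real_of_int N"
  have "c > 0"
    using \<open>N > 0\<close> \<open>m > 0\<close> by (simp add: c_def)
  define Z where "Z i = c \<cdot>\<^sub>m Y i" for i
  \<comment> \<open>Large enough both to hold matrices of size \<open>d\<close> and to admit the
    denominator \<open>N\<close>.\<close>
  define r where "r = max d (nat N)"
  have Zpsd: "Z i \<in> psd_mats d" for i
    unfolding Z_def using psd \<open>c > 0\<close> by (intro psd_mats_smult) auto
  have "mat_trace (Z i) = c * mat_trace (Y i)" for i
    using psd_mats_carrier[OF psd, of i] by (simp add: Z_def mat_trace_def sum_distrib_left)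
  then have "(\<Sum>i\<in>UNIV. mat_trace (Z i)) = c * (\<Sum>i\<in>UNIV. mat_trace (Y i))"
    by (simp add: sum_distrib_left)
  then have "(\<Sum>i\<in>UNIV. mat_trace (Z i)) = 1"
    using tr \<open>N > 0\<close> \<open>m > 0\<close> by (simp add: c_def)
  then have "(\<lambda>i. diag_sum (Z i) (0\<^sub>m (r - d) (r - d))) \<in> Delta_rat r"
  proof (rule Delta_rat_pad_zero[OF Zpsd])
    fix i k l assume kl: "k < d" "l < d"
    then have "Z i $$ (k, l) = real_of_int (round_num d m (X i) k l) / real_of_int N"
      using \<open>m > 0\<close> carrier_matD[OF round_mat_carrier, of d m "X i"]
      by (simp add: Z_def Y_def c_def round_mat_index)
    then show "\<exists>p q :: int. 1 \<le> q \<and> q \<le> int r \<and> Z i $$ (k, l) = real_of_int p / real_of_int q"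
      using \<open>N > 0\<close> by (intro exI[of _ "round_num d m (X i) k l"] exI[of _ N]) (auto simp: r_def)
  qed (simp add: r_def)
  then have "gram_matrix (\<lambda>i. diag_sum (Z i) (0\<^sub>m (r - d) (r - d))) \<in> C_cone r"
    unfolding C_cone_def by (intro hull_inc imageI)
  then have "gram_matrix Z \<in> C_cone r"
    using gram_matrix_pad_zero[of Z d "r - d"] Zpsd by (simp add: psd_mats_carrier)
  \<comment> \<open>The normalisation is undone inside the cone, since it changed the Gram matrix
    only by a positive factor.\<close>
  moreover have "gram_matrix Y = (1 / c\<^sup>2) *\<^sub>R gram_matrix Z"
    using gram_matrix_smult[of Y d c] psd \<open>c > 0\<close> by (simp add: Z_def[abs_def] psd_mats_carrier)
  ultimately have "gram_matrix Y \<in> C_cone r"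
    unfolding C_cone_def by (simp add: convex_cone_hull_mul)
  moreover have "r \<ge> 1"
    using \<open>d \<ge> 1\<close> by (simp add: r_def)
  ultimately show ?thesis
    by (auto simp: Y_def[abs_def])
qed

section \<open>Density of the union in the completely positive semidefinite cone\<close>

lemma round_mat_index_tendsto:
  assumes "k < d" "l < d"
  shows "(\<lambda>m. round_mat d (Suc m) X $$ (k, l)) \<longlonglongrightarrow> X $$ (k, l)"
proof -
  \<comment> \<open>The rounding error and the diagonal shift are shown to vanish separately. Using
    \<open>Suc m\<close> keeps the denominator positive at every index.\<close>
  have "(\<lambda>m. of_int \<lfloor>real (Suc m) * X $$ (k, l)\<rfloor> / real (Suc m) - X $$ (k, l)) \<longlonglongrightarrow> 0"
  proof (rule Lim_null_comparison)
    show "\<forall>\<^sub>F m in sequentially.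
        norm (of_int \<lfloor>real (Suc m) * X $$ (k, l)\<rfloor> / real (Suc m) - X $$ (k, l))
        \<le> inverse (real (Suc m))"
      using abs_floor_mult_div_le[of "Suc _" "X $$ (k, l)"]
      by (auto simp: inverse_eq_divide simp del: of_nat_Suc)
    show "(\<lambda>m. inverse (real (Suc m))) \<longlonglongrightarrow> 0"
      by (rule LIMSEQ_inverse_real_of_nat)
  qed
  moreover have "(\<lambda>m. (if k = l then real d else 0) * inverse (real (Suc m))) \<longlonglongrightarrow> 0"
    using tendsto_mult_left[OF LIMSEQ_inverse_real_of_nat] by force
  ultimately have "(\<lambda>m. (of_int \<lfloor>real (Suc m) * X $$ (k, l)\<rfloor> / real (Suc m) - X $$ (k, l)) +
      (if k = l then real d else 0) * inverse (real (Suc m)) + X $$ (k, l)) \<longlonglongrightarrow> 0 + 0 + X $$ (k, l)"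
    by (intro tendsto_add tendsto_const)
  moreover have "round_mat d (Suc m) X $$ (k, l) =
      (of_int \<lfloor>real (Suc m) * X $$ (k, l)\<rfloor> / real (Suc m) - X $$ (k, l)) +
      (if k = l then real d else 0) * inverse (real (Suc m)) + X $$ (k, l)" for m
    using assms
    by (simp add: round_mat_index round_num_def add_divide_distrib divide_inverse distrib_right
        del: of_nat_Suc)
  ultimately show ?thesis
    by (simp del: of_nat_Suc)
qed

lemma cpsd_cone_subset_closure: "cpsd_cone \<subseteq> closure (\<Union>r\<in>{1..}. C_cone r)"
proof
  fix A :: "real^'n^'n"
  assume "A \<in> cpsd_cone"
  then obtain d X where *: "d \<ge> 1" "\<And>i. X i \<in> psd_mats d" "A = gram_matrix X"
    by (auto simp: cpsd_cone_def)
  \<comment> \<open>With the size \<open>d\<close> fixed, the entries of the Gram matrix are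
    polynomials in the entries of the tuple, so entrywise convergence is enough.\<close>
  have "(\<lambda>m. gram_matrix (\<lambda>i. round_mat d (Suc m) (X i))) \<longlonglongrightarrow> gram_matrix X"
  proof (intro vec_tendstoI)
    fix i j
    have "(\<lambda>m. trace_inner (round_mat d (Suc m) (X i)) (round_mat d (Suc m) (X j)))
        \<longlonglongrightarrow> trace_inner (X i) (X j)"
      using psd_mats_carrier[OF *(2)]
      by (auto simp: trace_inner_eq_sum[of _ d] round_mat_carrier
          intro!: tendsto_sum tendsto_mult round_mat_index_tendsto)
    then show "(\<lambda>m. vec_nth (vec_nth (gram_matrix (\<lambda>i. round_mat d (Suc m) (X i))) i) j)
        \<longlonglongrightarrow> vec_nth (vec_nth (gram_matrix X) i) j"
      by (simp add: gram_matrix_def)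
  qed
  moreover have "gram_matrix (\<lambda>i. round_mat d (Suc m) (X i)) \<in> (\<Union>r\<in>{1..}. C_cone r)" for m
    using * by (intro gram_round_mat_in_Union_C_cone) auto
  ultimately show "A \<in> closure (\<Union>r\<in>{1..}. C_cone r)"
    unfolding closure_sequential *(3) by (intro exI conjI allI)
qed

section \<open>From density to the interior\<close>

lemma subspace_sym_mats: "subspace (sym_mats :: (real^'n^'n) set)"
  by (auto simp: subspace_def sym_mats_def Finite_Cartesian_Product.transpose_def
      Finite_Cartesian_Product.vec_eq_iff)

theorem theorem2p12:
  shows "top_of_set sym_mats interior_of (cpsd_cone :: (real^'n::finite^'n) set)
           \<subseteq> (\<Union>r\<in>{1..}. C_cone r)
         \<and> (\<Union>r\<in>{1..}. C_cone r) \<subseteq> (cpsd_cone :: (real^'n::finite^'n) set)"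
proof
  let ?C = "(\<Union>r\<in>{1..}. C_cone r) :: (real^'n^'n) set"
  show sub: "?C \<subseteq> cpsd_cone"
    by (rule UN_least) (simp add: C_cone_subset_cpsd_cone)
  show "top_of_set sym_mats interior_of (cpsd_cone :: (real^'n^'n) set) \<subseteq> ?C"
  proof
    fix A :: "real^'n^'n"
    assume "A \<in> top_of_set sym_mats interior_of cpsd_cone"
    then obtain U where U: "open U" "A \<in> sym_mats \<inter> U" "sym_mats \<inter> U \<subseteq> cpsd_cone"
      by (force simp: interior_of_def openin_open)
    have "?C \<subseteq> sym_mats"
      using sub by (auto simp: cpsd_cone_def)
    then have "closure ?C \<subseteq> sym_mats"
      by (intro closure_minimal closed_subspace subspace_sym_mats)
    \<comment> \<open>Relative interiors are taken in the affine hull, whereas \<open>U\<close> is a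
      neighbourhood within \<open>sym_mats\<close>. This inclusion lets \<open>U\<close> witness
      that \<open>A\<close> is a relative interior point of the closure.\<close>
    then have "affine hull closure ?C \<subseteq> sym_mats"
      by (intro hull_minimal subspace_imp_affine subspace_sym_mats)
    then have "U \<inter> affine hull closure ?C \<subseteq> closure ?C"
      using order_trans[OF U(3) cpsd_cone_subset_closure] by blast
    moreover have "A \<in> closure ?C"
      using U(2) order_trans[OF U(3) cpsd_cone_subset_closure] by (rule subsetD[rotated])
    ultimately have "A \<in> rel_interior (closure ?C)"
      unfolding rel_interior using U(1,2) by blast
    \<comment> \<open>Convexity of the union is what allows the closure to be dropped here; density
      alone would only place \<open>A\<close> in the closure.\<close>
    then have "A \<in> rel_interior ?C"
      by (simp only: convex_rel_interior_closure[OF convex_Union_C_cone])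
    then show "A \<in> ?C"
      by (rule subsetD[OF rel_interior_subset])
  qed
qed

end
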